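(* Let $\alpha\ge\beta\ge-\tfrac12$. Define $$P(x)=(1-x)\frac{p^{(\alpha+1,\beta)}_m(x)^2}{x^{(\alpha+1,\beta)}_{1,m}-x}\quad(m\ge1),\qquad Q(x)=(1-x^2)\frac{p^{(\alpha+1,\beta+1)}_{m-1}(x)^2}{x^{(\alpha+1,\beta+1)}_{1,m-1}-x}\quad(m\ge2),$$ where $x^{(a,b)}_{1,n}$ denotes the largest zero of $p^{(a,b)}_n$. Then $P$ and $Q$ are locally $s$-optimal in $\mathcal B^0_s(I;\alpha,\beta)$ for each $s\in\{+1,-1\}$.
   Context: $I=[-1,1]$; $w_{\alpha,\beta}(x)=c_{\alpha,\beta}(1-x)^\alpha(1+x)^\beta$ on $I$ normalized to a probability density; $P^{(\alpha,\beta)}_n$ Jacobi polynomials (orthogonal for $w_{\alpha,\beta}$, $P^{(\alpha,\beta)}_n(1)=\binom{n+\alpha}{n}$), $p^{(\alpha,\beta)}_n$ their $L^2(w_{\alpha,\beta})$-normalizations; $\widehat f(n)=\int_I f\,p^{(\alpha,\beta)}_nw_{\alpha,\beta}dx$. $\mathcal B_s(I;\alpha,\beta)$: continuous real $f$ on $I$ with $\widehat f(0)\le0$, $\{s\widehat f(n)\}$ eventually nonnegative, $sf(1)\le0$; $\mathcal B^0_s(I;\alpha,\beta)=\{f\in\mathcal B_s(I;\alpha,\beta): f(1)=0\}$. $r(f;I)=\inf\{r\in(0,2]: f\ge0\text{ on }[-1,1-r)\}$; $k(s\widehat f)=\min\{k\ge1:s\widehat f(n)\ge0\ \forall n\ge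 k\}$. A polynomial $f\in\mathcal B^0_s(I;\alpha,\beta)$ is locally $s$-optimal if there is $\delta>0$ such that $r(f;I)k(s\widehat f)^2<r(h;I)k(s\widehat h)^2$ for every polynomial $h\in\mathcal B^0_s(I;\alpha,\beta)$ with $\deg h\le\deg f$ and $0<\inf_{c>0}\|f-ch\|_{L^\infty(I)}<\delta$. *)

theory Defs
  imports "HOL-Analysis.Analysis" "HOL-Computational_Algebra.Polynomial"
begin

definition jacobiP :: "real \<Rightarrow> real \<Rightarrow> nat \<Rightarrow> real poly" where
  "jacobiP a b n = (\<Sum>k\<le>n. smult (((real n + a) gchoose (n - k)) * ((real n + b) gchoose k))
        ([:-1/2, 1/2:] ^ k * [:1/2, 1/2:] ^ (n - k)))"

definition jweight :: "real \<Rightarrow> real \<Rightarrow> real \<Rightarrow> real" where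
  "jweight a b x = (1 - x) powr a * (1 + x) powr b /
      integral {-1..1} (\<lambda>t. (1 - t) powr a * (1 + t) powr b)"

definition jacobip :: "real \<Rightarrow> real \<Rightarrow> nat \<Rightarrow> real poly" where
  "jacobip a b n = smult (1 / sqrt (integral {-1..1}
      (\<lambda>x. (poly (jacobiP a b n) x)\<^sup>2 * jweight a b x))) (jacobiP a b n)"

definition jcoeff :: "real \<Rightarrow> real \<Rightarrow> (real \<Rightarrow> real) \<Rightarrow> nat \<Rightarrow> real" where
  "jcoeff a b f n = integral {-1..1} (\<lambda>x. f x * poly (jacobip a b n) x * jweight a b x)"

definition largest_zero :: "real \<Rightarrow> real \<Rightarrow> nat \<Rightarrow> real" where
  "largest_zero a b n = Max {x. poly (jacobip a b n) x = 0}"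

definition classB :: "real \<Rightarrow> real \<Rightarrow> real \<Rightarrow> (real \<Rightarrow> real) \<Rightarrow> bool" where
  "classB s a b f \<longleftrightarrow> continuous_on {-1..1} f \<and> jcoeff a b f 0 \<le> 0 \<and>
     (\<forall>\<^sub>F n in sequentially. s * jcoeff a b f n \<ge> 0) \<and> s * f 1 \<le> 0"

definition classB0 :: "real \<Rightarrow> real \<Rightarrow> real \<Rightarrow> (real \<Rightarrow> real) \<Rightarrow> bool" where
  "classB0 s a b f \<longleftrightarrow> classB s a b f \<and> f 1 = 0"

definition rr :: "(real \<Rightarrow> real) \<Rightarrow> real" where
  "rr f = Inf {r \<in> {0<..2}. \<forall>x\<in>{-1..<1-r}. f x \<ge> 0}"

definition kk :: "(nat \<Rightarrow> real) \<Rightarrow> nat" where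
  "kk g = (LEAST k. k \<ge> 1 \<and> (\<forall>n\<ge>k. g n \<ge> 0))"

definition supnormI :: "(real \<Rightarrow> real) \<Rightarrow> real" where
  "supnormI f = (SUP x\<in>{-1..1}. \<bar>f x\<bar>)"

definition locally_s_optimal :: "real \<Rightarrow> real \<Rightarrow> real \<Rightarrow> real poly \<Rightarrow> bool" where
  "locally_s_optimal s a b f \<longleftrightarrow> classB0 s a b (poly f) \<and>
     (\<exists>\<delta>>0. \<forall>h::real poly. classB0 s a b (poly h) \<and> degree h \<le> degree f \<and>
        0 < (INF c\<in>{0<..}. supnormI (\<lambda>x. poly f x - c * poly h x)) \<and>
        (INF c\<in>{0<..}. supnormI (\<lambda>x. poly f x - c * poly h x)) < \<delta> \<longrightarrow>
        rr (poly f) * real (kk (\<lambda>n. s * jcoeff a b (poly f) n))^2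
          < rr (poly h) * real (kk (\<lambda>n. s * jcoeff a b (poly h) n))^2)"

(* P(x) = (1-x) p_m^{(a+1,b)}(x)^2 / (x_{1,m} - x)  (exact polynomial division) *)
definition Ppoly :: "real \<Rightarrow> real \<Rightarrow> nat \<Rightarrow> real poly" where
  "Ppoly a b m = [:1, -1:] * ((jacobip (a+1) b m)^2 div [:largest_zero (a+1) b m, -1:])"

definition Qpoly :: "real \<Rightarrow> real \<Rightarrow> nat \<Rightarrow> real poly" where
  "Qpoly a b m = [:1, 0, -1:] *
     ((jacobip (a+1) (b+1) (m-1))^2 div [:largest_zero (a+1) (b+1) (m-1), -1:])"

end

theory Submission
  imports Defs
begin

text \<open>A competitor \<open>h\<close> of the same degree with \<open>h 1 = 0\<close> is \<open>(1 - x) g\<close>, and \<open>jcoeff a b h 0 \<le> 0\<close>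
  says that \<open>g\<close> has nonpositive integral against \<open>(1 - x) powr (a + 1) * (1 + x) powr b\<close>. If the last
  sign change of \<open>h\<close> is no further from \<open>1\<close> than the largest node, then \<open>g\<close> is nonnegative at all nodes of
  a Gauss (for \<open>P\<close>) or Gauss--Radau (for \<open>Q\<close>) rule that is exact for \<open>g\<close> and has positive weights.
  So \<open>g\<close> vanishes at every node, to second order at those strictly between \<open>-1\<close> and the largest
  one; counting degrees, \<open>h\<close> is a multiple of the extremal polynomial. Orthogonality of the Jacobi
  polynomials comes from evaluating Beta integrals, which reduces it to the vanishing of an
  \<open>n\<close>-th finite difference of a polynomial of degree below \<open>n\<close>.\<close>

section \<open>Finite differences of rising factorials\<close>

text \<open>Up to sign this is the \<open>n\<close>-th finite difference of a polynomial in
  \<open>k\<close> of degree \<open>i < n\<close>. Pascal's rule lowers \<open>n\<close> by one at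
  the cost of one difference, and differencing a rising factorial lowers its length by one.\<close>

lemma alternating_binomial_pochhammer_sum:
  fixes x :: real
  assumes "i < n"
  shows "(\<Sum>k\<le>n. (-1) ^ k * real (n choose k) * pochhammer (x + real k) i) = 0"
  using assms
proof (induction n arbitrary: i x)
  case 0
  then show ?case by simp
next
  case (Suc n)
  define f where "f k = pochhammer (x + real k) i" for k
  have "(\<Sum>k\<le>Suc n. (-1) ^ k * real (Suc n choose k) * f k) =
      f 0 + (\<Sum>k\<le>n. (-1) ^ Suc k * real (n choose Suc k) * f (Suc k)) +
      (\<Sum>k\<le>n. (-1) ^ Suc k * real (n choose k) * f (Suc k))"
    by (simp add: sum.atMost_Suc_shift algebra_simps sum.distrib sum_subtractf sum_negf
        del: sum.atMost_Suc)
  also have "f 0 + (\<Sum>k\<le>n. (-1) ^ Suc k * real (n choose Suc k) * f (Suc k)) =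
      (\<Sum>k\<le>Suc n. (-1) ^ k * real (n choose k) * f k)"
    by (simp add: sum.atMost_Suc_shift del: sum.atMost_Suc)
  also have "\<dots> = (\<Sum>k\<le>n. (-1) ^ k * real (n choose k) * f k)"
    by simp
  also have "\<dots> + (\<Sum>k\<le>n. (-1) ^ Suc k * real (n choose k) * f (Suc k)) =
      (\<Sum>k\<le>n. (-1) ^ k * real (n choose k) * (f k - f (Suc k)))"
    by (simp add: algebra_simps sum.distrib sum_subtractf sum_negf)
  also have "\<dots> = 0"
  proof (cases i)
    case 0
    then show ?thesis by (simp add: f_def)
  next
    case (Suc j)
    have "f k - f (Suc k) = - real i * pochhammer (x + 1 + real k) j" for k
      unfolding f_def Suc pochhammer_rec[of "x + real k"] pochhammer_rec'[of "x + real (Suc k)"]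
      by (simp add: algebra_simps)
    then have "(\<Sum>k\<le>n. (-1) ^ k * real (n choose k) * (f k - f (Suc k))) =
        - real i * (\<Sum>k\<le>n. (-1) ^ k * real (n choose k) * pochhammer (x + 1 + real k) j)"
      by (simp add: sum_distrib_left mult_ac)
    then show ?thesis
      using Suc.IH[of j "x + 1"] Suc Suc.prems by simp
  qed
  finally show ?case by (simp add: f_def)
qed

section \<open>Integrals of polynomials against the Jacobi weight\<close>

text \<open>The weight is left unnormalized: only signs and zeros of integrals matter, and factors
  \<open>1 - x\<close> or \<open>1 + x\<close> can then move into the weight without changing
  constants.\<close>

definition jint :: "real \<Rightarrow> real \<Rightarrow> real poly \<Rightarrow> real" where
  "jint a b p = integral {-1..1} (\<lambda>x. poly p x * ((1 - x) powr a * (1 + x) powr b))"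

text \<open>The substitution \<open>t = (1 + x) / 2\<close> reduces this to Euler's Beta integral on
  the unit interval.\<close>

lemma has_integral_jacobi_weight:
  fixes a b :: real
  assumes "a > -1" "b > -1"
  shows "((\<lambda>x. (1 - x) powr a * (1 + x) powr b) has_integral
           2 powr (a + b + 1) * Beta (b + 1) (a + 1)) {-1..1}"
proof -
  have "((\<lambda>t. t powr b * (1 - t) powr a) has_integral Beta (b + 1) (a + 1)) (cbox 0 1)"
    using has_integral_Beta_real[of "b + 1" "a + 1"] assms by simp
  from has_integral_affinity'[OF this, of "1/2" "1/2"]
  have "((\<lambda>x. ((1/2) * x + 1/2) powr b * (1 - ((1/2) * x + 1/2)) powr a) has_integral
      2 * Beta (b + 1) (a + 1)) {-1..1}"
    by (simp add: mult.commute)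
  from has_integral_mult_right[OF this, of "2 powr (a + b)"]
  have "((\<lambda>x. 2 powr (a + b) * (((1/2) * x + 1/2) powr b * (1 - ((1/2) * x + 1/2)) powr a))
      has_integral 2 powr (a + b + 1) * Beta (b + 1) (a + 1)) {-1..1}"
    by (simp add: powr_add mult_ac)
  then show ?thesis
  proof (rule has_integral_eq[rotated])
    fix x :: real assume x: "x \<in> {-1..1}"
    have 1: "(1/2) * x + 1/2 = (1 + x) / 2" "1 - (1 + x) / 2 = (1 - x) / 2"
      by (simp_all add: field_simps)
    show "2 powr (a + b) * (((1/2) * x + 1/2) powr b * (1 - ((1/2) * x + 1/2)) powr a) =
        (1 - x) powr a * (1 + x) powr b"
      unfolding 1 using x by (simp add: powr_divide powr_add)
  qed
qed

text \<open>At \<open>x = 0\<close> both sides vanish because \<open>0 powr c = 0\<close> for every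
  \<open>c\<close>, so the identity can be used up to the endpoints of the interval.\<close>

lemma power_mult_powr: "0 \<le> (x::real) \<Longrightarrow> x ^ i * x powr a = x powr (a + real i)"
  by (cases "x = 0") (auto simp: powr_add powr_realpow)

lemma has_integral_jacobi_weight_powers:
  fixes a b :: real
  assumes "a > -1" "b > -1"
  shows "((\<lambda>x. (1 - x) ^ i * (1 + x) ^ j * ((1 - x) powr a * (1 + x) powr b)) has_integral
           2 powr (a + real i + (b + real j) + 1) * Beta (b + real j + 1) (a + real i + 1)) {-1..1}"
proof (rule has_integral_eq[OF _ has_integral_jacobi_weight])
  fix x :: real assume "x \<in> {-1..1}"
  then show "(1 - x) powr (a + real i) * (1 + x) powr (b + real j) =
      (1 - x) ^ i * (1 + x) ^ j * ((1 - x) powr a * (1 + x) powr b)"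
    by (simp add: mult_ac flip: power_mult_powr)
qed (use assms in auto)

text \<open>Powers of \<open>1 - x\<close> merge with the weight, so each term of this expansion is
  again a Beta integral. The map \<open>1 - x\<close> is its own inverse, hence the single
  composition.\<close>

lemma poly_expand_at_one:
  fixes p :: "real poly"
  shows "poly p x = (\<Sum>i\<le>degree p. coeff (p \<circ>\<^sub>p [:1, -1:]) i * (1 - x) ^ i)"
proof -
  have "poly p x = poly (p \<circ>\<^sub>p [:1, -1:]) (1 - x)"
    by (simp add: poly_pcompose)
  then show ?thesis by (simp add: poly_altdef degree_pcompose)
qed

lemma jacobi_weight_integrable:
  fixes a b :: real
  assumes "a > -1" "b > -1"
  shows "(\<lambda>x. poly p x * ((1 - x) powr a * (1 + x) powr b)) integrable_on {-1..1}"
proof -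
  have "(\<lambda>x. \<Sum>i\<le>degree p. coeff (p \<circ>\<^sub>p [:1, -1:]) i *
      ((1 - x) ^ i * (1 + x) ^ 0 * ((1 - x) powr a * (1 + x) powr b))) integrable_on {-1..1}"
    by (intro integrable_sum integrable_on_mult_right finite_atMost
        has_integral_integrable[OF has_integral_jacobi_weight_powers[OF assms]])
  then show ?thesis
    by (subst poly_expand_at_one) (simp add: sum_distrib_right mult.assoc)
qed

context
  fixes a b :: real
  assumes ab: "a > -1" "b > -1"
begin

lemma jint_add: "jint a b (p + q) = jint a b p + jint a b q"
  unfolding jint_def by (simp add: ring_distribs integral_add jacobi_weight_integrable ab)

lemma jint_smult: "jint a b (smult c p) = c * jint a b p"
  unfolding jint_def by (simp add: mult.assoc)

lemma jint_nonneg: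
  assumes "\<And>x. x \<in> {-1..1} \<Longrightarrow> poly p x \<ge> 0"
  shows "jint a b p \<ge> 0"
  unfolding jint_def using assms ab
  by (intro integral_nonneg jacobi_weight_integrable) auto

text \<open>The weight may be singular at the endpoints, so the argument is made on
  \<open>{-1/2..1/2}\<close>, where the integrand is continuous: a zero integral would force
  infinitely many roots.\<close>

lemma jint_pos:
  assumes nonneg: "\<And>x. x \<in> {-1..1} \<Longrightarrow> poly p x \<ge> 0" and "p \<noteq> 0"
  shows "jint a b p > 0"
proof (rule ccontr)
  assume "\<not> jint a b p > 0"
  define w where "w = (\<lambda>x. poly p x * ((1 - x) powr a * (1 + x) powr b))"
  have cont: "continuous_on {-1/2..1/2} w"
    unfolding w_def by (intro continuous_intros) auto
  then have int: "w integrable_on {-1/2..1/2}"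
    using integrable_continuous_real by blast
  have wnn: "w x \<ge> 0" if "x \<in> {-1..1}" for x
    unfolding w_def using nonneg[OF that] by simp
  have "integral {-1/2..1/2} w \<le> integral {-1..1} w"
    using jacobi_weight_integrable[OF ab, of p] wnn
    by (intro integral_subset_le int) (auto simp: w_def)
  also have "\<dots> = jint a b p"
    by (simp add: w_def jint_def)
  finally have "integral {-1/2..1/2} w \<le> 0"
    using \<open>\<not> jint a b p > 0\<close> by simp
  moreover have "integral {-1/2..1/2} w \<ge> 0"
    using int wnn by (intro integral_nonneg) auto
  ultimately have "(w has_integral 0) (cbox (-1/2) (1/2))"
    using int by (simp add: has_integral_iff)
  then have "w x = 0" if "x \<in> {-1/2..1/2}" for x
    using has_integral_0_cbox_imp_0[of "-1/2" "1/2" w x] cont wnn that by auto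
  then have "{-1/2..1/2} \<subseteq> {x. poly p x = 0}"
    by (force simp: w_def)
  then have "finite {-1/2..1/2::real}"
    using poly_roots_finite[OF \<open>p \<noteq> 0\<close>] finite_subset by blast
  then show False
    using infinite_Icc[of "-1/2" "1/2::real"] by simp
qed

lemma jint_abs_le:
  assumes "\<And>x. x \<in> {-1..1} \<Longrightarrow> \<bar>poly p x\<bar> \<le> K"
  shows "\<bar>jint a b p\<bar> \<le> K * jint a b 1"
proof -
  have "jint a b ([:K:] - p) \<ge> 0" "jint a b ([:K:] + p) \<ge> 0"
    using assms by (intro jint_nonneg; fastforce simp: abs_le_iff)+
  moreover have "jint a b ([:K:] + smult c p) = K * jint a b 1 + c * jint a b p" for c
    using jint_smult[of K 1] by (simp add: jint_add jint_smult)
  from this[of 1] this[of "-1"]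
  have "jint a b ([:K:] + p) = K * jint a b 1 + jint a b p"
       "jint a b ([:K:] - p) = K * jint a b 1 - jint a b p" by simp_all
  ultimately show ?thesis by (simp add: abs_le_iff)
qed

end

text \<open>Source of the parameter \<open>a + 1\<close>: the factor \<open>1 - x\<close> shared by
  all competitors is absorbed into the weight.\<close>

lemma jint_shift_left: "jint a b ([:1, -1:] * p) = jint (a + 1) b p"
  unfolding jint_def
proof (rule integral_cong)
  fix x :: real assume "x \<in> {-1..1}"
  then have *: "(1 - x) powr (a + 1) = (1 - x) * (1 - x) powr a"
    using power_mult_powr[of "1 - x" 1 a] by simp
  show "poly ([:1, -1:] * p) x * ((1 - x) powr a * (1 + x) powr b) =
      poly p x * ((1 - x) powr (a + 1) * (1 + x) powr b)"
    unfolding * by (simp add: algebra_simps)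
qed

lemma jint_shift_right: "jint a b ([:1, 1:] * p) = jint a (b + 1) p"
  unfolding jint_def
proof (rule integral_cong)
  fix x :: real assume "x \<in> {-1..1}"
  then have *: "(1 + x) powr (b + 1) = (1 + x) * (1 + x) powr b"
    using power_mult_powr[of "1 + x" 1 b] by simp
  show "poly ([:1, 1:] * p) x * ((1 - x) powr a * (1 + x) powr b) =
      poly p x * ((1 - x) powr a * (1 + x) powr (b + 1))"
    unfolding * by (simp add: algebra_simps)
qed

section \<open>Orthogonality of the Jacobi polynomials\<close>

text \<open>Each term of \<open>jacobiP\<close> times \<open>(1 - x) ^ i\<close> gives a Beta value.
  Its Gamma factors depending on \<open>k\<close> cancel against the generalized binomials, up to a
  rising factorial of length \<open>i\<close>, and an alternating binomial sum remains.\<close>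

lemma jint_jacobiP_power_eq_0:
  fixes a b :: real
  assumes ab: "a > -1" "b > -1" and "i < n"
  shows "jint a b (jacobiP a b n * [:1, -1:] ^ i) = 0"
proof -
  \<comment> \<open>\<open>C k\<close> is the coefficient of
    \<open>(1 - x) ^ k * (1 + x) ^ (n - k)\<close> in \<open>jacobiP a b n\<close>; \<open>G\<close>
    below gathers everything that does not depend on \<open>k\<close>.\<close>
  define C where "C k = ((real n + a) gchoose (n - k)) * ((real n + b) gchoose k) * (-1) ^ k / 2 ^ n" for k
  define G where "G = Gamma (real n + a + 1) * Gamma (real n + b + 1) / fact n / 2 ^ n *
      2 powr (a + real i + b + real n + 1) / Gamma (a + b + real n + real i + 2)"
  have expand: "poly (jacobiP a b n * [:1, -1:] ^ i) x =
      (\<Sum>k\<le>n. C k * ((1 - x) ^ (k + i) * (1 + x) ^ (n - k)))" for x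
  proof -
    have *: "((x - 1) / 2) ^ k * ((x + 1) / 2) ^ (n - k) * (1 - x) ^ i =
       (-1) ^ k / 2 ^ n * ((1 - x) ^ (k + i) * (1 + x) ^ (n - k))" if "k \<le> n" for k
    proof -
      have "(x - 1) ^ k = (-1) ^ k * (1 - x) ^ k"
        by (simp flip: power_mult_distrib)
      moreover have "(2::real) ^ n = 2 ^ k * 2 ^ (n - k)"
        using that by (simp flip: power_add)
      ultimately show ?thesis
        by (simp add: power_divide power_add add.commute)
    qed
    have "poly (jacobiP a b n * [:1, -1:] ^ i) x =
      (\<Sum>k\<le>n. ((real n + a) gchoose (n - k)) * ((real n + b) gchoose k) *
         (((x - 1) / 2) ^ k * ((x + 1) / 2) ^ (n - k) * (1 - x) ^ i))"
      unfolding jacobiP_def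
      by (simp add: poly_sum sum_distrib_left sum_distrib_right diff_divide_distrib add_divide_distrib add_ac mult_ac)
    also have "\<dots> = (\<Sum>k\<le>n. C k * ((1 - x) ^ (k + i) * (1 + x) ^ (n - k)))"
      by (intro sum.cong refl) (simp add: * C_def)
    finally show ?thesis .
  qed
  have "((\<lambda>x. \<Sum>k\<le>n. C k * ((1 - x) ^ (k + i) * (1 + x) ^ (n - k) * ((1 - x) powr a * (1 + x) powr b)))
      has_integral (\<Sum>k\<le>n. C k * (2 powr (a + real (k + i) + (b + real (n - k)) + 1) *
          Beta (b + real (n - k) + 1) (a + real (k + i) + 1)))) {-1..1}"
    by (intro has_integral_sum has_integral_mult_right has_integral_jacobi_weight_powers ab) auto
  then have "jint a b (jacobiP a b n * [:1, -1:] ^ i) =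
      (\<Sum>k\<le>n. C k * (2 powr (a + real (k + i) + (b + real (n - k)) + 1) *
          Beta (b + real (n - k) + 1) (a + real (k + i) + 1)))"
    unfolding jint_def expand by (simp add: sum_distrib_right mult.assoc integral_unique)
  also have "\<dots> = (\<Sum>k\<le>n. G * ((-1) ^ k * real (n choose k) * pochhammer (a + 1 + real k) i))"
  proof (intro sum.cong refl)
    fix k assume "k \<in> {..n}"
    then have k: "k \<le> n" by simp
    have nonpos: "x \<notin> \<int>\<^sub>\<le>\<^sub>0" if "x > 0" for x :: real
      using that by (auto elim!: nonpos_Ints_cases)
    have pos: "Gamma (a + 1 + real k) > 0" "Gamma (b + 1 + real (n - k)) > 0"
      using ab by (intro Gamma_real_pos; linarith)+
    have g1: "(real n + a) gchoose (n - k) = 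
        Gamma (real n + a + 1) / (fact (n - k) * Gamma (a + 1 + real k))"
      using gbinomial_Gamma[of "real n + a" "n - k"] nonpos[of "real n + a + 1"] ab k
      by (simp add: of_nat_diff add_ac)
    have g2: "(real n + b) gchoose k = 
        Gamma (real n + b + 1) / (fact k * Gamma (b + 1 + real (n - k)))"
      using gbinomial_Gamma[of "real n + b" "k"] nonpos[of "real n + b + 1"] ab k
      by (simp add: of_nat_diff algebra_simps)
    have g3: "Gamma (a + real (k + i) + 1) = pochhammer (a + 1 + real k) i * Gamma (a + 1 + real k)"
    proof -
      have "a + real (k + i) + 1 = a + 1 + real k + real i" by simp
      moreover have "pochhammer (a + 1 + real k) i = Gamma (a + 1 + real k + real i) / Gamma (a + 1 + real k)"
        using ab by (intro pochhammer_Gamma nonpos) simp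
      ultimately show ?thesis
        using less_imp_neq[OF pos(1)] by (simp only:) simp
    qed
    have g4: "Beta (b + real (n - k) + 1) (a + real (k + i) + 1) =
        Gamma (b + 1 + real (n - k)) * (pochhammer (a + 1 + real k) i * Gamma (a + 1 + real k)) /
        Gamma (a + b + real n + real i + 2)"
      unfolding Beta_def g3 using k by (simp add: of_nat_diff add_ac)
    have g5: "real (n choose k) = fact n / (fact k * fact (n - k))"
      using k by (rule binomial_fact)
    have g6: "a + real (k + i) + (b + real (n - k)) + 1 = a + real i + b + real n + 1"
      using k by (simp add: of_nat_diff)
    show "C k * (2 powr (a + real (k + i) + (b + real (n - k)) + 1) *
          Beta (b + real (n - k) + 1) (a + real (k + i) + 1)) =
        G * ((-1) ^ k * real (n choose k) * pochhammer (a + 1 + real k) i)"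
      unfolding C_def G_def g1 g2 g4 g5 g6 using pos by (simp add: field_simps)
  qed
  also have "\<dots> = 0"
    using alternating_binomial_pochhammer_sum[OF \<open>i < n\<close>, of "a + 1"]
    by (simp flip: sum_distrib_left)
  finally show ?thesis .
qed

lemma jint_sum:
  assumes "a > -1" "b > -1"
  shows "jint a b (sum f A) = (\<Sum>x\<in>A. jint a b (f x))"
proof (induction A rule: infinite_finite_induct)
  case (insert x A)
  then show ?case using assms by (simp add: jint_add)
qed (simp_all add: jint_def)

lemma jint_jacobiP_orthogonal:
  fixes a b :: real
  assumes ab: "a > -1" "b > -1" and "degree q < n"
  shows "jint a b (jacobiP a b n * q) = 0"
proof -
  have "q = (\<Sum>i\<le>degree q. smult (coeff (q \<circ>\<^sub>p [:1, -1:]) i) ([:1, -1:] ^ i))"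
    by (rule poly_ext) (subst poly_expand_at_one, simp add: poly_sum)
  then have "jint a b (jacobiP a b n * q) = 
     jint a b (\<Sum>i\<le>degree q. smult (coeff (q \<circ>\<^sub>p [:1, -1:]) i) (jacobiP a b n * [:1, -1:] ^ i))"
    by (metis (no_types, lifting) mult_smult_right sum.cong sum_distrib_left)
  also have "\<dots> = 0"
    using assms by (simp add: jint_sum jint_smult jint_jacobiP_power_eq_0)
  finally show ?thesis .
qed

section \<open>Zeros of orthogonal polynomials\<close>

lemma poly_prod_linear_eq_0_iff:
  fixes Y :: "'a :: idom set"
  assumes "finite Y"
  shows "poly (\<Prod>y\<in>Y. [:-y, 1:]) x = 0 \<longleftrightarrow> x \<in> Y"
  using assms by (auto simp: poly_prod)

text \<open>The factors at distinct points are coprime: the product over the earlier points does not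
  vanish at the new point \<open>z\<close>, so the full order of \<open>g\<close> at
  \<open>z\<close> passes to the cofactor.\<close>

lemma prod_linear_powers_dvd:
  fixes g :: "'a :: idom poly"
  assumes "finite Y" "\<And>y. y \<in> Y \<Longrightarrow> [:-y, 1:] ^ k y dvd g"
  shows "(\<Prod>y\<in>Y. [:-y, 1:] ^ k y) dvd g"
  using assms
proof (induction Y rule: finite_induct)
  case (insert z Y)
  let ?N = "\<Prod>y\<in>Y. [:-y, 1:] ^ k y"
  from insert obtain u where u: "g = ?N * u"
    by (auto elim: dvdE)
  show ?case
  proof (cases "g = 0")
    case False
    have "poly ?N z \<noteq> 0"
      using insert by (auto simp: poly_prod)
    then have "order z ?N = 0"
      by (rule order_0I)
    then have "order z g = order z u"
      using False u order_mult[of ?N u z] by simp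
    then have "[:-z, 1:] ^ k z dvd u"
      using insert.prems[of z] False u by (auto simp: order_divides)
    then have "?N * [:-z, 1:] ^ k z dvd g"
      unfolding u by (rule mult_dvd_mono[OF dvd_refl])
    then show ?thesis
      using insert by (simp add: mult.commute)
  qed simp
qed simp

text \<open>\<open>S\<close> is built as the set of zeros of odd order in the open interval. The
  induction splits off one root \<open>s\<close> at a time and toggles its membership in
  \<open>S\<close>.\<close>

lemma sign_correcting_prod_exists:
  fixes p :: "real poly"
  assumes "p \<noteq> 0"
  obtains S \<sigma> where "finite S" "S \<subseteq> {-1<..<1}" "\<And>x. x \<in> S \<Longrightarrow> poly p x = 0"
    "\<sigma> = 1 \<or> \<sigma> = (-1::real)"
    "\<And>x. x \<in> {-1<..<1} \<Longrightarrow> \<sigma> * poly (p * (\<Prod>y\<in>S. [:-y, 1:])) x \<ge> 0"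
proof -
  have "\<exists>S \<sigma>. finite S \<and> S \<subseteq> {-1<..<1} \<and> (\<forall>x\<in>S. poly p x = 0) \<and> (\<sigma> = 1 \<or> \<sigma> = (-1::real)) \<and>
      (\<forall>x\<in>{-1<..<1}. \<sigma> * poly (p * (\<Prod>y\<in>S. [:-y, 1:])) x \<ge> 0)"
    using assms
  proof (induction "degree p" arbitrary: p rule: less_induct)
    case less
    show ?case
    proof (cases "\<exists>s\<in>{-1<..<1}. poly p s = 0")
      case False
      have "(\<forall>x\<in>{-1<..<1}. poly p x \<ge> 0) \<or> (\<forall>x\<in>{-1<..<1}. poly p x \<le> 0)"
      proof (rule ccontr)
        assume "\<not> ?thesis"
        then obtain x y where xy: "x \<in> {-1<..<1}" "y \<in> {-1<..<1}" "poly p x < 0" "poly p y > 0"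
          by force
        consider "x < y" | "y < x" using xy by fastforce
        then show False
        proof cases
          case 1
          then show False using poly_IVT_pos[OF 1 xy(3,4)] xy False by fastforce
        next
          case 2
          then show False using poly_IVT_neg[OF 2 xy(4,3)] xy False by fastforce
        qed
      qed
      then show ?thesis
      proof
        assume "\<forall>x\<in>{-1<..<1}. poly p x \<ge> 0"
        then show ?thesis by (intro exI[of _ "{}"] exI[of _ 1]) auto
      next
        assume "\<forall>x\<in>{-1<..<1}. poly p x \<le> 0"
        then show ?thesis by (intro exI[of _ "{}"] exI[of _ "-1"]) auto
      qed
    next
      case True
      then obtain s where s: "s \<in> {-1<..<1}" "poly p s = 0" by blast
      then obtain u where u: "p = [:-s, 1:] * u"
        by (auto simp: poly_eq_0_iff_dvd elim: dvdE)
      have "u \<noteq> 0" using u less.prems by auto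
      then have "degree u < degree p"
        unfolding u by (subst degree_mult_eq) auto
      from less.hyps[OF this \<open>u \<noteq> 0\<close>]
      obtain S \<sigma> where S: "finite S" "S \<subseteq> {-1<..<1}" "\<forall>x\<in>S. poly u x = 0" "\<sigma> = 1 \<or> \<sigma> = (-1::real)"
        "\<forall>x\<in>{-1<..<1}. \<sigma> * poly (u * (\<Prod>y\<in>S. [:-y, 1:])) x \<ge> 0"
        by blast
      show ?thesis
      proof (cases "s \<in> S")
        case True
        have "p * (\<Prod>y\<in>S - {s}. [:-y, 1:]) = u * (\<Prod>y\<in>S. [:-y, 1:])"
          unfolding u prod.remove[OF S(1) True] by (simp only: mult_ac)
        then have "\<forall>x\<in>{-1<..<1}. \<sigma> * poly (p * (\<Prod>y\<in>S - {s}. [:-y, 1:])) x \<ge> 0"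
          using S(5) by (simp only:)
        moreover have "finite (S - {s})" "\<forall>x\<in>S - {s}. poly p x = 0"
          using S(1,3) by (simp_all add: u)
        ultimately show ?thesis
          using S(2,4) by blast
      next
        case False
        \<comment> \<open>Adding \<open>s\<close> to \<open>S\<close> changes the product by the
          square of a linear factor, which keeps the sign.\<close>
        have nonneg: "\<sigma> * poly ([:-s, 1:]^2 * (u * (\<Prod>y\<in>S. [:-y, 1:]))) x \<ge> 0" 
          if "x \<in> {-1<..<1}" for x
        proof -
          have "0 \<le> (poly [:-s, 1:] x)^2 * (\<sigma> * poly (u * (\<Prod>y\<in>S. [:-y, 1:])) x)"
            by (rule mult_nonneg_nonneg[OF zero_le_power2 S(5)[rule_format, OF that]])
          then show ?thesis by (simp only: poly_mult poly_power mult_ac)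
        qed
        have "p * (\<Prod>y\<in>insert s S. [:-y, 1:]) = [:-s, 1:]^2 * (u * (\<Prod>y\<in>S. [:-y, 1:]))"
          unfolding u prod.insert[OF S(1) False] by (simp only: mult_ac power2_eq_square)
        then have "\<forall>x\<in>{-1<..<1}. \<sigma> * poly (p * (\<Prod>y\<in>insert s S. [:-y, 1:])) x \<ge> 0"
          using nonneg by (simp only:) blast
        moreover have "finite (insert s S)" "insert s S \<subseteq> {-1<..<1}" "\<forall>x\<in>insert s S. poly p x = 0"
          using S(1-3) s by (simp_all add: u)
        ultimately show ?thesis
          using S(4) by blast
      qed
    qed
  qed
  then show thesis using that by blast
qed

lemma poly_nonneg_closure:
  fixes p :: "real poly"
  assumes "\<And>x. x \<in> {u<..<v} \<Longrightarrow> poly p x \<ge> 0" "u < v" "x \<in> {u..v}"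
  shows "poly p x \<ge> 0"
proof -
  have "poly p x \<ge> 0" if "x \<in> closure {u<..<v}"
    by (rule continuous_ge_on_closure[OF _ that])
      (use assms(1) in \<open>auto intro!: continuous_intros\<close>)
  then show ?thesis using assms by simp
qed

text \<open>With fewer than \<open>n\<close> sign changes, the sign-correcting product would be an
  admissible test polynomial, yet its integral against \<open>p\<close> is nonzero. Then
  \<open>n \<le> card S \<le> card roots \<le> degree p \<le> n\<close> forces equality
  throughout.\<close>

lemma roots_of_orthogonal_poly:
  fixes a b :: real
  assumes ab: "a > -1" "b > -1" and "p \<noteq> 0" "degree p \<le> n"
    and orth: "\<And>q. degree q < n \<Longrightarrow> jint a b (p * q) = 0"
  shows "degree p = n" "card {x. poly p x = 0} = n" "{x. poly p x = 0} \<subseteq> {-1<..<1}"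
proof -
  obtain S \<sigma> where S: "finite S" "S \<subseteq> {-1<..<1}" "\<And>x. x \<in> S \<Longrightarrow> poly p x = 0"
    "\<sigma> = 1 \<or> \<sigma> = (-1::real)" 
    "\<And>x. x \<in> {-1<..<1} \<Longrightarrow> \<sigma> * poly (p * (\<Prod>y\<in>S. [:-y, 1:])) x \<ge> 0"
    using sign_correcting_prod_exists[OF \<open>p \<noteq> 0\<close>] by blast
  define q where "q = (\<Prod>y\<in>S. [:-y, 1:])"
  have q: "q \<noteq> 0" "degree q = card S"
    using S(1) unfolding q_def by (auto simp: degree_prod_eq_sum_degree)
  have fin: "finite {x. poly p x = 0}"
    using poly_roots_finite[OF \<open>p \<noteq> 0\<close>] .
  have "card S \<ge> n"
  proof (rule ccontr)
    assume "\<not> card S \<ge> n"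
    then have "jint a b (smult \<sigma> (p * q)) = 0"
      using orth[of q] q ab by (simp add: jint_smult)
    moreover have "jint a b (smult \<sigma> (p * q)) > 0"
    proof (rule jint_pos[OF ab])
      show "poly (smult \<sigma> (p * q)) x \<ge> 0" if "x \<in> {-1..1}" for x
        using poly_nonneg_closure[of "-1" 1 "smult \<sigma> (p * q)" x] S(5) that 
        by (simp add: q_def)
      show "smult \<sigma> (p * q) \<noteq> 0" using q S \<open>p \<noteq> 0\<close> by auto
    qed
    ultimately show False by simp
  qed
  moreover have sub: "S \<subseteq> {x. poly p x = 0}" using S by auto
  moreover note card_mono[OF fin sub] card_poly_roots_bound[OF \<open>p \<noteq> 0\<close>] \<open>degree p \<le> n\<close>
  ultimately show "degree p = n" "card {x. poly p x = 0} = n" by auto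
  with \<open>card S \<ge> n\<close> have "S = {x. poly p x = 0}"
    using card_seteq[OF fin sub] by simp
  with S(2) show "{x. poly p x = 0} \<subseteq> {-1<..<1}" by blast
qed

section \<open>Quadrature with positive weights\<close>

text \<open>Replacing the Lagrange basis by its squares makes positivity of the quadrature
  weights immediate; exactness in degree \<open>2 (card Y - 1)\<close> is all this needs.\<close>

lemma positive_quadrature_zero:
  fixes a b :: real
  assumes ab: "a > -1" "b > -1" and "finite Y"
    and orth: "\<And>q. degree ((\<Prod>y\<in>Y. [:-y, 1:]) * q) \<le> d \<Longrightarrow> jint a b ((\<Prod>y\<in>Y. [:-y, 1:]) * q) = 0"
    and d: "2 * (card Y - 1) \<le> d" "degree g \<le> d"
    and g: "\<And>y. y \<in> Y \<Longrightarrow> poly g y \<ge> 0" "jint a b g \<le> 0" and y: "y \<in> Y"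
  shows "poly g y = 0"
proof -
  define l where "l y = (\<Prod>z\<in>Y-{y}. [:-z, 1:])" for y
  have l0: "poly (l y) z = 0 \<longleftrightarrow> z \<in> Y - {y}" for y z
    unfolding l_def using \<open>finite Y\<close> by (intro poly_prod_linear_eq_0_iff) auto
  have ln: "l y \<noteq> 0" for y
    unfolding l_def using \<open>finite Y\<close> by simp
  have "degree (l y) = card Y - 1" if "y \<in> Y" for y
    unfolding l_def using \<open>finite Y\<close> that by (simp add: degree_prod_eq_sum_degree)
  then have dl: "degree (l y ^ 2) \<le> d" if "y \<in> Y" for y
    using d(1) that by (simp add: degree_power_eq ln)
  \<comment> \<open>\<open>r\<close> interpolates \<open>g\<close> on \<open>Y\<close>, so
    \<open>g - r\<close> is a multiple of the node polynomial within the range of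
    \<open>orth\<close>, and \<open>g\<close> and \<open>r\<close> have the same integral.\<close>
  define r where "r = (\<Sum>y\<in>Y. smult (poly g y / (poly (l y) y)^2) (l y ^ 2))"
  have "poly (g - r) z = 0" if "z \<in> Y" for z
  proof -
    have "poly r z = (\<Sum>y\<in>Y. if y = z then poly g z else 0)"
      unfolding r_def poly_sum using that l0[of z z] by (intro sum.cong refl) (auto simp: l0)
    then show ?thesis using that \<open>finite Y\<close> by simp
  qed
  then have "(\<Prod>y\<in>Y. [:-y, 1:] ^ 1) dvd g - r"
    by (intro prod_linear_powers_dvd \<open>finite Y\<close>) (simp only: poly_eq_0_iff_dvd power_one_right)
  then obtain q where q: "g - r = (\<Prod>y\<in>Y. [:-y, 1:]) * q"
    by (auto elim: dvdE)
  have "degree r \<le> d"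
    unfolding r_def by (intro degree_sum_le \<open>finite Y\<close>) (auto intro: order_trans[OF degree_smult_le] dl)
  then have "degree (g - r) \<le> d"
    using d(2) by (intro degree_diff_le)
  then have "jint a b (g - r) = 0"
    unfolding q by (rule orth)
  then have "jint a b g = jint a b r"
    using jint_add[OF ab, of "g - r" r] by simp
  also have "\<dots> = (\<Sum>y\<in>Y. poly g y / (poly (l y) y)^2 * jint a b (l y ^ 2))"
    unfolding r_def by (simp add: jint_sum jint_smult ab)
  finally have sum: "(\<Sum>y\<in>Y. poly g y / (poly (l y) y)^2 * jint a b (l y ^ 2)) \<le> 0"
    using g by simp
  have pos: "jint a b (l y ^ 2) > 0" for y
    using ln by (intro jint_pos ab) auto
  have nn: "poly g y / (poly (l y) y)^2 * jint a b (l y ^ 2) \<ge> 0" if "y \<in> Y" for y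
    using g(1)[OF that] less_imp_le[OF pos] by simp
  with sum have "(\<Sum>y\<in>Y. poly g y / (poly (l y) y)^2 * jint a b (l y ^ 2)) = 0"
    by (meson antisym sum_nonneg)
  then have "poly g y / (poly (l y) y)^2 * jint a b (l y ^ 2) = 0"
    using sum_nonneg_0[where f = "\<lambda>y. poly g y / (poly (l y) y)^2 * jint a b (l y ^ 2)",
        OF \<open>finite Y\<close> nn _ y] by blast
  then show ?thesis
    using less_imp_neq[OF pos[of y]] l0[of y y] by simp
qed

text \<open>A zero inside an interval of nonnegativity is a local minimum, so the derivative
  vanishes there too.\<close>

lemma double_root_of_nonneg:
  fixes g :: "real poly"
  assumes "poly g y = 0" "u < y" "y < v" "\<And>x. x \<in> {u<..<v} \<Longrightarrow> poly g x \<ge> 0"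
  shows "[:-y, 1:] ^ 2 dvd g"
proof -
  obtain q where q: "g = [:-y, 1:] * q"
    using assms(1) by (auto simp: poly_eq_0_iff_dvd elim: dvdE)
  have "poly (pderiv g) y = 0"
  proof (rule DERIV_local_min[OF poly_DERIV])
    show "0 < min (y - u) (v - y)" using assms by simp
    show "\<forall>x. \<bar>y - x\<bar> < min (y - u) (v - y) \<longrightarrow> poly g y \<le> poly g x"
      using assms by (auto simp: abs_less_iff)
  qed
  then have "poly q y = 0"
    by (simp add: q pderiv_mult pderiv_pCons del: mult_pCons_left)
  then have "[:-y, 1:] dvd q"
    by (simp add: poly_eq_0_iff_dvd)
  then show ?thesis
    unfolding q power2_eq_square by (rule mult_dvd_mono[OF dvd_refl])
qed

section \<open>Jacobi coefficients of polynomials and their continuity\<close>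

lemma jacobiP_0: "jacobiP a b 0 = 1"
  by (simp add: jacobiP_def)

lemma degree_jacobiP_le: "degree (jacobiP a b n) \<le> n"
  unfolding jacobiP_def
proof (rule degree_sum_le)
  fix k assume k: "k \<in> {..n}"
  have "degree ([:-1/2, 1/2:] ^ k * [:1/2, 1/2:] ^ (n - k) :: real poly) = n"
    using k by (simp add: degree_mult_eq degree_power_eq)
  then show "degree (smult ((real n + a gchoose n - k) * (real n + b gchoose k))
      ([:-1/2, 1/2:] ^ k * [:1/2, 1/2:] ^ (n - k))) \<le> n"
    by (metis degree_smult_le)
qed simp

text \<open>At \<open>x = 1\<close> only the term \<open>k = 0\<close> survives, and the binomial
  there is a product of positive factors when \<open>a > -1\<close>.\<close>

lemma jacobiP_nonzero:
  fixes a b :: real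
  assumes "a > -1"
  shows "jacobiP a b n \<noteq> 0"
proof -
  have "poly (jacobiP a b n) 1 = (\<Sum>k\<le>n. if k = 0 then (real n + a) gchoose n else 0)"
    unfolding jacobiP_def poly_sum by (intro sum.cong refl) auto
  also have "\<dots> = (real n + a) gchoose n"
    by simp
  also have "\<dots> > 0"
    unfolding gbinomial_prod_rev using assms
    by (intro divide_pos_pos prod_pos) auto
  finally show ?thesis by auto
qed

text \<open>All normalizations go into one positive constant independent of \<open>f\<close>, so
  sign questions about coefficients become questions about \<open>jint\<close>.\<close>

lemma jcoeff_poly:
  fixes a b :: real
  assumes ab: "a > -1" "b > -1"
  obtains C where "C > 0" "\<And>f. jcoeff a b (poly f) n = C * jint a b (f * jacobiP a b n)"
proof -
  define Z where "Z = jint a b 1"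
  have Z: "Z > 0" unfolding Z_def by (rule jint_pos[OF ab]) auto
  have w: "jweight a b x = (1 - x) powr a * (1 + x) powr b / Z" for x
    by (simp add: jweight_def Z_def jint_def)
  define N where "N = integral {-1..1} (\<lambda>x. (poly (jacobiP a b n) x)\<^sup>2 * jweight a b x)"
  have "N = jint a b ((jacobiP a b n)^2) / Z"
    unfolding N_def w jint_def by (simp flip: integral_divide)
  moreover have "jint a b ((jacobiP a b n)^2) > 0"
    using jacobiP_nonzero[OF ab(1)] by (intro jint_pos[OF ab]) auto
  ultimately have N: "N > 0" using Z by simp
  have "jcoeff a b (poly f) n = (1 / sqrt N / Z) * jint a b (f * jacobiP a b n)" for f
  proof -
    have "jcoeff a b (poly f) n = integral {-1..1} (\<lambda>x. (1 / sqrt N / Z) *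
        (poly (f * jacobiP a b n) x * ((1 - x) powr a * (1 + x) powr b)))"
      unfolding jcoeff_def jacobip_def N_def[symmetric] unfolding w by (simp add: mult_ac)
    then show ?thesis by (simp only: integral_mult_right jint_def)
  qed
  moreover have "1 / sqrt N / Z > 0" using N Z by simp
  ultimately show thesis using that by blast
qed

lemma jcoeff_diff_smult:
  fixes a b :: real
  assumes "a > -1" "b > -1"
  shows "jcoeff a b (poly (f - smult c h)) n = jcoeff a b (poly f) n - c * jcoeff a b (poly h) n"
proof -
  obtain C where C: "\<And>f. jcoeff a b (poly f) n = C * jint a b (f * jacobiP a b n)"
    using jcoeff_poly[OF assms] by metis
  have "jint a b ((f - smult c h) * jacobiP a b n) =
      jint a b (f * jacobiP a b n + smult (-c) (h * jacobiP a b n))"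
    by (simp add: algebra_simps)
  then show ?thesis
    unfolding C using assms by (simp only: jint_add jint_smult) (simp add: algebra_simps)
qed

lemma jcoeff_eq_0:
  fixes a b :: real
  assumes "a > -1" "b > -1" "degree f < n"
  shows "jcoeff a b (poly f) n = 0"
proof -
  obtain C where C: "\<And>f. jcoeff a b (poly f) n = C * jint a b (f * jacobiP a b n)"
    using jcoeff_poly[OF assms(1,2)] by metis
  show ?thesis
    using jint_jacobiP_orthogonal[OF assms] by (simp add: C mult.commute)
qed

lemma bdd_above_poly_image: "bdd_above ((\<lambda>x. \<bar>poly u x\<bar>) ` {-1..1::real})"
  by (intro bounded_imp_bdd_above compact_imp_bounded compact_continuous_image continuous_intros) auto

lemma supnormI_upper: "x \<in> {-1..1} \<Longrightarrow> \<bar>poly u x\<bar> \<le> supnormI (poly u)"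
  unfolding supnormI_def by (rule cSUP_upper[OF _ bdd_above_poly_image])

lemma supnormI_nonneg: "supnormI (poly u) \<ge> 0"
  using supnormI_upper[of 0 u] by simp

lemma supnormI_pos:
  assumes "u \<noteq> 0"
  shows "supnormI (poly u) > 0"
proof (rule ccontr)
  assume "\<not> ?thesis"
  then have "\<bar>poly u x\<bar> \<le> 0" if "x \<in> {-1..1}" for x
    using supnormI_upper[OF that, of u] by linarith
  then have "{-1..1} \<subseteq> {x. poly u x = 0}" by auto
  then have "finite {-1..1::real}"
    using poly_roots_finite[OF assms] finite_subset by blast
  then show False using infinite_Icc[of "-1" "1::real"] by simp
qed

text \<open>Continuity of a coefficient in the sup norm: a strictly negative coefficient stays
  negative under small perturbations.\<close>

lemma jcoeff_bounded:
  fixes a b :: real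
  assumes ab: "a > -1" "b > -1"
  obtains M where "M > 0" "\<And>u. \<bar>jcoeff a b (poly u) n\<bar> \<le> M * supnormI (poly u)"
proof -
  obtain C where C: "C > 0" "\<And>f. jcoeff a b (poly f) n = C * jint a b (f * jacobiP a b n)"
    using jcoeff_poly[OF assms] by metis
  define M where "M = C * supnormI (poly (jacobiP a b n)) * jint a b 1"
  have "M > 0"
    unfolding M_def using C(1) jacobiP_nonzero[OF ab(1), of b n]
    by (intro mult_pos_pos supnormI_pos jint_pos[OF ab]) auto
  moreover have "\<bar>jcoeff a b (poly u) n\<bar> \<le> M * supnormI (poly u)" for u
  proof -
    have "\<bar>jint a b (u * jacobiP a b n)\<bar> \<le>
        (supnormI (poly u) * supnormI (poly (jacobiP a b n))) * jint a b 1"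
      by (intro jint_abs_le[OF ab])
        (auto simp: abs_mult intro!: mult_mono supnormI_upper supnormI_nonneg)
    from mult_left_mono[OF this, of C] show ?thesis
      using C(1) by (simp add: C(2) abs_mult M_def mult_ac)
  qed
  ultimately show thesis using that by blast
qed

section \<open>The functionals \<open>kk\<close> and \<open>rr\<close>, and a criterion for local
  optimality\<close>

text \<open>Eventual nonnegativity makes the \<open>LEAST\<close> meaningful. The guard
  \<open>kk g > 1\<close> matters: since candidates start at 1, \<open>kk g = 1\<close> says nothing
  about \<open>g 0\<close>.\<close>

lemma kk_props:
  assumes "\<forall>\<^sub>F n in sequentially. g n \<ge> (0::real)"
  shows "kk g \<ge> 1" "\<And>n. n \<ge> kk g \<Longrightarrow> g n \<ge> 0" "kk g > 1 \<Longrightarrow> g (kk g - 1) < 0"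
proof -
  let ?P = "\<lambda>k. k \<ge> 1 \<and> (\<forall>n\<ge>k. g n \<ge> 0)"
  obtain K where "\<forall>n\<ge>K. g n \<ge> 0"
    using assms by (auto simp: eventually_sequentially)
  then have "?P (max 1 K)" by simp
  then have P: "?P (kk g)"
    unfolding kk_def by (rule LeastI)
  then show "kk g \<ge> 1" "\<And>n. n \<ge> kk g \<Longrightarrow> g n \<ge> 0" by auto
  assume "kk g > 1"
  then have "\<not> ?P (kk g - 1)"
    unfolding kk_def by (intro not_less_Least) (simp add: kk_def)
  then obtain n where n: "n \<ge> kk g - 1" "g n < 0"
    using \<open>kk g > 1\<close> by force
  with P have "n = kk g - 1"
    by (metis Suc_leI Suc_pred' le_neq_implies_less not_less \<open>kk g \<ge> 1\<close> less_le_trans zero_less_one)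
  with n show "g (kk g - 1) < 0" by simp
qed

lemma rr_le:
  assumes "z \<in> {-1<..<1}" "\<And>x. x \<in> {-1..<z} \<Longrightarrow> f x \<ge> 0"
  shows "rr f \<le> 1 - z"
  unfolding rr_def using assms
  by (intro cInf_lower) (auto intro!: bdd_belowI[of _ 0])

lemma rr_nonneg: "rr f \<ge> 0"
  unfolding rr_def by (rule cInf_greatest) (auto intro!: exI[of _ 2])

text \<open>The infimum itself need not be admissible, but each \<open>x < z\<close> leaves room for
  an admissible radius below \<open>1 - x\<close>. The radius 2 is always admissible, as its
  condition is empty.\<close>

lemma nonneg_of_rr_le:
  assumes "rr f \<le> 1 - z" "x \<in> {-1..<z}"
  shows "f x \<ge> 0"
proof -
  have "rr f < 1 - x" using assms by simp
  moreover have "{r \<in> {0<..2}. \<forall>x\<in>{-1..<1-r}. f x \<ge> 0} \<noteq> {}"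
    by (auto intro!: exI[of _ 2])
  ultimately obtain r where "r \<in> {r \<in> {0<..2}. \<forall>x\<in>{-1..<1-r}. f x \<ge> 0}" "r < 1 - x"
    unfolding rr_def by (metis (no_types, lifting) cInf_lessD)
  then show ?thesis using assms by auto
qed

text \<open>The index \<open>kk\<close> cannot drop under small perturbations, because its minimality is
  witnessed by one strictly negative coefficient. Hence only the factor \<open>rr\<close> matters.\<close>

lemma locally_s_optimalI:
  fixes a b s z :: real
  assumes ab: "a > -1" "b > -1" and s: "s \<in> {1, -1}" and z: "z \<in> {-1<..<1}"
    and f: "f \<noteq> 0" "poly f 1 = 0" "jint a b f = 0" "\<And>x. x \<in> {-1..<z} \<Longrightarrow> poly f x \<ge> 0"
    and unique: "\<And>h. degree h \<le> degree f \<Longrightarrow> poly h 1 = 0 \<Longrightarrow> jint a b h \<le> 0 \<Longrightarrow>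
        (\<And>x. x \<in> {-1..<z} \<Longrightarrow> poly h x \<ge> 0) \<Longrightarrow> \<exists>c\<ge>0. h = smult c f"
  shows "locally_s_optimal s a b f"
proof -
  define J where "J h n = s * jcoeff a b (poly h) n" for h n
  obtain C where C: "C > 0" "\<And>f. jcoeff a b (poly f) 0 = C * jint a b f"
    using jcoeff_poly[OF ab, of 0] by (metis jacobiP_0 mult.right_neutral)
  \<comment> \<open>The coefficients of a polynomial vanish beyond its degree, so the sign condition
    holds for both values of \<open>s\<close>.\<close>
  have ev: "\<forall>\<^sub>F n in sequentially. J f n \<ge> 0"
    using eventually_gt_at_top[of "degree f"]
    by eventually_elim (simp add: J_def jcoeff_eq_0 ab)
  have f_B: "classB0 s a b (poly f)"
    using ev f unfolding classB0_def classB_def J_def by (auto simp: C intro: continuous_intros)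
  define k where "k = kk (J f)"
  obtain M where M: "M > 0" "\<And>u. \<bar>jcoeff a b (poly u) (k - 1)\<bar> \<le> M * supnormI (poly u)"
    using jcoeff_bounded[OF ab] by blast
  \<comment> \<open>A perturbation of sup norm below \<open>\<epsilon>\<close> moves coefficient
    \<open>k - 1\<close> by less than its absolute value. For \<open>k = 1\<close> the index cannot
    drop, and 1 is an arbitrary default.\<close>
  define \<epsilon> where "\<epsilon> = (if k > 1 then - J f (k - 1) / M else 1)"
  \<comment> \<open>The bound by the norm of \<open>f\<close> excludes the competitor
    \<open>h = 0\<close>.\<close>
  define \<delta> where "\<delta> = min (supnormI (poly f)) \<epsilon>"
  have "\<epsilon> > 0"
    using kk_props(3)[OF ev] M(1) by (auto simp: \<epsilon>_def k_def intro!: divide_neg_pos)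
  then have "\<delta> > 0"
    unfolding \<delta>_def using supnormI_pos[OF f(1)] by simp
  have better: "rr (poly f) * real (kk (J f))^2 < rr (poly h) * real (kk (J h))^2"
    if h: "classB0 s a b (poly h)" "degree h \<le> degree f"
      and pos: "0 < (INF c\<in>{0<..}. supnormI (\<lambda>x. poly f x - c * poly h x))"
      and lt: "(INF c\<in>{0<..}. supnormI (\<lambda>x. poly f x - c * poly h x)) < \<delta>" for h
  proof -
    have diff: "(\<lambda>x. poly f x - c * poly h x) = poly (f - smult c h)" for c
      by (simp add: fun_eq_iff)
    obtain c where c: "c > 0" "supnormI (poly (f - smult c h)) < \<delta>"
      using cInf_lessD[OF _ lt] unfolding diff by auto
    have evh: "\<forall>\<^sub>F n in sequentially. J h n \<ge> 0"
      and h1: "poly h 1 = 0" and h0: "jint a b h \<le> 0"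
      using h(1) C by (auto simp: classB0_def classB_def J_def mult_le_0_iff)
    have kle: "kk (J f) \<le> kk (J h)"
    proof (rule ccontr)
      assume less: "\<not> ?thesis"
      then have k: "k > 1" and "J h (k - 1) \<ge> 0"
        using kk_props(1,2)[OF evh] by (auto simp: k_def)
      have "\<bar>jcoeff a b (poly (f - smult c h)) (k - 1)\<bar> \<le> M * supnormI (poly (f - smult c h))"
        by (rule M)
      also have "\<dots> < M * \<epsilon>"
        using c M(1) by (auto simp: \<delta>_def)
      also have "M * \<epsilon> = - J f (k - 1)"
        using M(1) k by (simp add: \<epsilon>_def)
      finally have "\<bar>s * jcoeff a b (poly (f - smult c h)) (k - 1)\<bar> < - J f (k - 1)"
        using s by auto
      moreover have "s * jcoeff a b (poly (f - smult c h)) (k - 1) = J f (k - 1) - c * J h (k - 1)"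
        unfolding jcoeff_diff_smult[OF ab] J_def by (simp add: algebra_simps)
      ultimately have "c * J h (k - 1) < 0" by linarith
      then show False
        using \<open>J h (k - 1) \<ge> 0\<close> c(1) by (simp add: mult_less_0_iff)
    qed
    have "rr (poly f) < rr (poly h)"
    proof (rule ccontr)
      assume "\<not> ?thesis"
      then have rrh: "rr (poly h) \<le> 1 - z"
        using rr_le[of z "poly f", OF z f(4)] by simp
      \<comment> \<open>A competitor with \<open>rr\<close> no larger than that of \<open>f\<close>
        is a multiple of \<open>f\<close>: \<open>t = 0\<close> contradicts the choice of
        \<open>\<delta>\<close>, and \<open>t > 0\<close> makes the infimum zero through the scale
        \<open>1 / t\<close>.\<close>
      then obtain t where t: "t \<ge> 0" "h = smult t f"
        using unique[OF h(2) h1 h0 nonneg_of_rr_le[OF rrh]] by blast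
      show False
      proof (cases "t = 0")
        case True
        then have "supnormI (poly (f - smult c h)) = supnormI (poly f)"
          using t by simp
        with c show False by (simp add: \<delta>_def)
      next
        case False
        have "(INF c\<in>{0<..}. supnormI (\<lambda>x. poly f x - c * poly h x)) \<le>
            supnormI (\<lambda>x. poly f x - (1 / t) * poly h x)"
          using False t unfolding diff
          by (intro cINF_lower bdd_belowI2[of _ 0] supnormI_nonneg) auto
        also have "\<dots> = 0"
          using False t by (simp add: supnormI_def)
        finally show False using pos by simp
      qed
    qed
    then have "rr (poly f) * real (kk (J h))^2 < rr (poly h) * real (kk (J h))^2"
      using kk_props(1)[OF evh] by (intro mult_strict_right_mono) auto
    moreover have "rr (poly f) * real (kk (J f))^2 \<le> rr (poly f) * real (kk (J h))^2"
      using kle rr_nonneg by (intro mult_left_mono power_mono) auto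
    ultimately show ?thesis by linarith
  qed
  show ?thesis
    unfolding locally_s_optimal_def
    using f_B \<open>\<delta> > 0\<close> better[unfolded J_def] by blast
qed

section \<open>Uniqueness of the extremal polynomial\<close>

text \<open>\<open>E = {}\<close> is Gauss quadrature and gives \<open>P\<close>; \<open>E = {-1}\<close> is Gauss--Radau
  quadrature and gives \<open>Q\<close>.\<close>

lemma locally_s_optimal_node_poly:
  fixes a b s :: real and p :: "real poly"
  assumes ab: "a > -1" "b > -1" and s: "s \<in> {1, -1}" and E: "E = {} \<or> E = {-1}"
    and p: "p \<noteq> 0" "degree p \<le> n" and n: "n \<ge> 1"
    and orth: "\<And>q. degree q < n \<Longrightarrow> jint (a + 1) (b + real (card E)) (p * q) = 0"
  defines "z \<equiv> Max {x. poly p x = 0}"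
  shows "locally_s_optimal s a b ([:1, -1:] * ((\<Prod>y\<in>E. [:-y, 1:]) * (p^2 div [:z, -1:])))"
proof -
  note [simp del] = mult_pCons_left mult_pCons_right
  define X where "X = {x. poly p x = 0}"
  define e where "e = (\<Prod>y\<in>E. [:-y, 1:])"
  have b': "b + real (card E) > -1" using ab by simp
  note roots = roots_of_orthogonal_poly[OF _ b' p orth]
  have deg: "degree p = n" and cX: "card X = n" and X: "X \<subseteq> {-1<..<1}"
    using roots ab unfolding X_def by auto
  have fX: "finite X" "finite E" and disj: "E \<inter> X = {}"
    using E X cX n by (auto intro: card_ge_0_finite)
  have "X \<noteq> {}" using cX n by auto
  then have zX: "z \<in> X" and le_z: "\<And>y. y \<in> X \<Longrightarrow> y \<le> z"
    unfolding z_def using fX(1) by (auto simp flip: X_def)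
  have z: "z \<in> {-1<..<1}" using zX X by auto
  define PX where "PX = (\<Prod>y\<in>X. [:-y, 1:])"
  define R where "R = (\<Prod>y\<in>X - {z}. [:-y, 1:])"
  have PX: "PX = [:-z, 1:] * R"
    unfolding PX_def R_def by (rule prod.remove[OF fX(1) zX])
  have dPX: "degree PX = n" "PX \<noteq> 0"
    unfolding PX_def using cX fX by (simp_all add: degree_prod_eq_sum_degree)
  have R0: "R \<noteq> 0" and dR: "degree R = n - 1"
    unfolding R_def using cX fX zX by (simp_all add: degree_prod_eq_sum_degree)
  have e0: "e \<noteq> 0" and de: "degree e = card E"
    unfolding e_def using fX by (simp_all add: degree_prod_eq_sum_degree)
  have e_nonneg: "poly e x \<ge> 0" if "x \<ge> -1" for x
    using E that by (auto simp: e_def)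
  \<comment> \<open>\<open>e\<close> is \<open>1\<close> or \<open>1 + x\<close>, so it raises the
    second parameter by \<open>card E\<close>.\<close>
  have jint_e: "jint A b (e * g) = jint A (b + real (card E)) g" for A g
    using E jint_shift_right[of A b g] by (auto simp: e_def)

  have "(\<Prod>y\<in>X. [:-y, 1:] ^ 1) dvd p"
    by (intro prod_linear_powers_dvd fX) (simp add: X_def poly_eq_0_iff_dvd)
  then obtain v where v: "p = PX * v"
    by (auto simp: PX_def elim: dvdE)
  have "v \<noteq> 0" using v p by auto
  then have "degree v = 0"
    using degree_mult_eq[OF dPX(2), of v] v deg dPX by simp
  then obtain c where "v = [:c:]" by (rule degree_eq_zeroE)
  then have c: "p = smult c PX" "c \<noteq> 0" using v \<open>v \<noteq> 0\<close> by (auto simp: mult_pCons_right)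

  define G where "G = e * ([:-z, 1:] * R^2)"
  define f where "f = smult (-(c^2)) ([:1, -1:] * G)"
  \<comment> \<open>The minus sign arises because the division is by \<open>z - x\<close>, while the
    node factors are \<open>x - y\<close>.\<close>
  have "p^2 = smult (-(c^2)) ([:-z, 1:] * R^2) * [:z, -1:]"
  proof (rule poly_ext)
    show "poly (p^2) x = poly (smult (-(c^2)) ([:-z, 1:] * R^2) * [:z, -1:]) x" for x
      unfolding c PX by (simp add: power2_eq_square algebra_simps)
  qed
  moreover have "[:z, -1:] \<noteq> 0" by simp
  ultimately have "p^2 div [:z, -1:] = smult (-(c^2)) ([:-z, 1:] * R^2)"
    by (simp only: nonzero_mult_div_cancel_right not_False_eq_True)
  then have f_eq: "[:1, -1:] * (e * (p^2 div [:z, -1:])) = f"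
    unfolding f_def G_def by (simp only: mult_smult_right)
  have G0: "G \<noteq> 0" using e0 R0 by (auto simp: G_def)
  have dG: "degree G = card E + (2 * n - 1)"
    unfolding G_def using e0 R0 n
    by (simp add: degree_mult_eq degree_power_eq de dR)
  have f0: "f \<noteq> 0" and df: "degree f = Suc (degree G)"
    unfolding f_def using c(2) G0 by (simp_all add: degree_mult_eq)
  have poly_f: "poly f x = c^2 * (1 - x) * poly e x * (z - x) * (poly R x)^2" for x
    by (simp add: f_def G_def algebra_simps power2_eq_square)
  have f_nonneg: "poly f x \<ge> 0" if "x \<in> {-1..<z}" for x
    unfolding poly_f using that z e_nonneg[of x] by (intro mult_nonneg_nonneg) auto
  have "jint a b f = jint (a + 1) b (smult (-(c^2)) G)"
    unfolding f_def by (simp only: jint_shift_left flip: mult_smult_right)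
  \<comment> \<open>One copy of \<open>p\<close> is kept whole; the other, stripped of its largest
    root, has degree \<open>n - 1\<close> and is a valid test polynomial.\<close>
  also have "smult (-(c^2)) G = e * (p * smult (-c) R)"
    unfolding G_def c PX by (simp add: power2_eq_square algebra_simps)
  also have "jint (a + 1) b \<dots> = 0"
    unfolding jint_e using dR n c(2) by (intro orth) simp
  finally have f_int: "jint a b f = 0" .

  have "locally_s_optimal s a b f"
  proof (rule locally_s_optimalI[OF ab s z f0 _ f_int f_nonneg])
    show "poly f 1 = 0" by (simp add: poly_f)
    fix h assume h: "degree h \<le> degree f" "poly h 1 = 0" "jint a b h \<le> 0"
      and h_nonneg: "\<And>x. x \<in> {-1..<z} \<Longrightarrow> poly h x \<ge> 0"
    have "[:-1, 1:] dvd h" using h(2) by (simp add: poly_eq_0_iff_dvd)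
    then obtain g' where "h = [:-1, 1:] * g'" by (auto elim: dvdE)
    then have "h = [:1, -1:] * (-g')" by (simp add: mult_pCons_left)
    then obtain g where g: "h = [:1, -1:] * g" by blast
    show "\<exists>t\<ge>0. h = smult t f"
    proof (cases "h = 0")
      case True
      then show ?thesis by (intro exI[of _ 0]) simp
    next
      case False
      then have "g \<noteq> 0" using g by auto
      then have dg: "degree g \<le> degree G"
        using h(1) unfolding g df by (simp add: degree_mult_eq)
      \<comment> \<open>The sign condition on \<open>h\<close> stops short of \<open>z\<close>;
        continuity extends it to the node \<open>z\<close> itself.\<close>
      have "poly g x \<ge> 0" if "x \<in> {-1<..<z}" for x
        using h_nonneg[of x] that z by (auto simp: g zero_le_mult_iff)
      from poly_nonneg_closure[OF this]
      have g_nonneg: "poly g x \<ge> 0" if "x \<in> {-1..z}" for x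
        using that z by simp
      have Y: "E \<union> X \<subseteq> {-1..z}" using E X le_z z by auto
      have prodY: "(\<Prod>y\<in>E \<union> X. [:-y, 1:]) = e * PX"
        unfolding e_def PX_def by (rule prod.union_disjoint) (use fX disj in auto)
      have root: "poly g y = 0" if "y \<in> E \<union> X" for y
      proof (rule positive_quadrature_zero[where Y = "E \<union> X" and a = "a + 1" and b = b and d = "degree G"])
        show "jint (a + 1) b ((\<Prod>y\<in>E \<union> X. [:-y, 1:]) * q) = 0"
          if "degree ((\<Prod>y\<in>E \<union> X. [:-y, 1:]) * q) \<le> degree G" for q
        proof -
          \<comment> \<open>The node polynomial has degree \<open>card E + n\<close> and
            \<open>G\<close> has degree \<open>card E + 2 * n - 1\<close>.\<close>
          have "degree q < n"
          proof (cases "q = 0")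
            case False
            then show ?thesis
              using that n unfolding prodY dG
              by (simp add: degree_mult_eq e0 dPX de)
          qed (use n in simp)
          then have "jint (a + 1) (b + real (card E)) (p * smult (1 / c) q) = 0"
            by (intro orth) (use c(2) in simp)
          moreover have "e * PX * q = e * (p * smult (1 / c) q)"
            using c by (simp add: mult.assoc)
          ultimately show ?thesis
            unfolding prodY by (simp only: jint_e)
        qed
        have "card (E \<union> X) = card E + n"
          using fX disj cX by (simp add: card_Un_disjoint)
        \<comment> \<open>The degree bound
          \<open>2 * (card E + n - 1) \<le> card E + 2 * n - 1\<close> amounts to
          \<open>card E \<le> 1\<close>.\<close>
        moreover have "card E \<le> 1" using E by auto
        ultimately show "2 * (card (E \<union> X) - 1) \<le> degree G"
          unfolding dG using n by linarith
        show "jint (a + 1) b g \<le> 0"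
          using h(3) unfolding g jint_shift_left .
        show "poly g y \<ge> 0" if "y \<in> E \<union> X" for y
          using g_nonneg Y that by blast
      qed (use ab fX dg that in auto)
      \<comment> \<open>Nonnegativity of \<open>g\<close> is known on one side only at
        \<open>z\<close> and at \<open>-1\<close>, so these count once and all other nodes twice.
        The multiplicities add up to \<open>degree G\<close>, leaving only a constant
        cofactor.\<close>
      define k :: "real \<Rightarrow> nat" where "k y = (if y \<in> X - {z} then 2 else 1)" for y
      have "(\<Prod>y\<in>E \<union> X. [:-y, 1:] ^ k y) dvd g"
      proof (rule prod_linear_powers_dvd)
        fix y assume y: "y \<in> E \<union> X"
        show "[:-y, 1:] ^ k y dvd g"
        proof (cases "y \<in> X - {z}")
          case True
          then have "-1 < y" "y < z" using X le_z[of y] by auto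
          then have "[:-y, 1:] ^ 2 dvd g"
            using double_root_of_nonneg[OF root[OF y], of "-1" z] g_nonneg by auto
          with True show ?thesis by (simp only: k_def if_True)
        next
          case False
          then have "k y = 1" by (simp add: k_def)
          then show ?thesis
            using root[OF y] by (simp only: poly_eq_0_iff_dvd power_one_right)
        qed
      qed (use fX in auto)
      also have "(\<Prod>y\<in>E \<union> X. [:-y, 1:] ^ k y) = (\<Prod>y\<in>E. [:-y, 1:] ^ k y) * (\<Prod>y\<in>X. [:-y, 1:] ^ k y)"
        by (rule prod.union_disjoint) (use fX disj in auto)
      also have "(\<Prod>y\<in>E. [:-y, 1:] ^ k y) = e"
        unfolding e_def using disj by (intro prod.cong refl) (auto simp: k_def)
      also have "(\<Prod>y\<in>X. [:-y, 1:] ^ k y) = [:-z, 1:] ^ k z * (\<Prod>y\<in>X - {z}. [:-y, 1:] ^ k y)"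
        by (rule prod.remove[OF fX(1) zX])
      also have "(\<Prod>y\<in>X - {z}. [:-y, 1:] ^ k y) = (\<Prod>y\<in>X - {z}. [:-y, 1:] ^ 2)"
        by (intro prod.cong refl) (simp only: k_def if_True)
      also have "\<dots> = R^2"
        unfolding R_def by (simp only: prod_power_distrib)
      also have "[:-z, 1:] ^ k z = [:-z, 1:]"
        by (simp add: k_def)
      finally have "G dvd g" by (simp only: G_def)
      then obtain q where q: "g = G * q" by (elim dvdE)
      have "q \<noteq> 0" using q \<open>g \<noteq> 0\<close> by auto
      then have "degree q = 0"
        using dg degree_mult_eq[OF G0, of q] q by simp
      then obtain t where t: "q = [:t:]" by (rule degree_eq_zeroE)
      define t' where "t' = - t / c^2"
      have hf: "h = smult t' f"
        unfolding g q t f_def t'_def using c(2) by (simp add: mult_pCons_right)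
      \<comment> \<open>A point where \<open>f\<close> is positive and \<open>h\<close> nonnegative
        fixes the sign of the factor \<open>t'\<close>.\<close>
      have "infinite ({-1<..<z} - {x. poly f x = 0})"
        using z poly_roots_finite[OF f0] infinite_Ioo[of "-1" z] by (intro Diff_infinite_finite) auto
      then obtain x where x: "x \<in> {-1<..<z}" "poly f x \<noteq> 0"
        by (metis (mono_tags, lifting) DiffE ex_in_conv finite.emptyI mem_Collect_eq)
      then have "poly f x > 0" using f_nonneg[of x] by simp
      moreover have "t' * poly f x \<ge> 0" using h_nonneg[of x] x hf by simp
      ultimately have "t' \<ge> 0" by (simp add: zero_le_mult_iff)
      with hf show ?thesis by blast
    qed
  qed
  then show ?thesis
    unfolding f_eq[symmetric] e_def .
qed

section \<open>Normalized Jacobi polynomials and the two extremal families\<close>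

lemma jacobip_eq_smult:
  fixes a b :: real
  assumes ab: "a > -1" "b > -1"
  obtains c where "c \<noteq> 0" "jacobip a b n = smult c (jacobiP a b n)"
proof -
  obtain C where C: "C > 0" "\<And>f. jcoeff a b (poly f) n = C * jint a b (f * jacobiP a b n)"
    using jcoeff_poly[OF ab] by metis
  have "jint a b (jacobiP a b n * jacobiP a b n) > 0"
    using jacobiP_nonzero[OF ab(1)] by (intro jint_pos[OF ab]) auto
  \<comment> \<open>If the normalizing factor were zero, \<open>jacobip\<close> and with it this
    coefficient would vanish.\<close>
  with C have "jcoeff a b (poly (jacobiP a b n)) n \<noteq> 0" by simp
  then have "jacobip a b n \<noteq> 0" by (auto simp: jcoeff_def)
  then show thesis
    by (intro that[OF _ jacobip_def]) (auto simp: jacobip_def)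
qed

lemma jacobip_orthogonal:
  fixes a b :: real
  assumes ab: "a > -1" "b > -1"
  shows "jacobip a b n \<noteq> 0" "degree (jacobip a b n) \<le> n"
    "\<And>q. degree q < n \<Longrightarrow> jint a b (jacobip a b n * q) = 0"
proof -
  obtain c where c: "c \<noteq> 0" "jacobip a b n = smult c (jacobiP a b n)"
    using jacobip_eq_smult[OF ab] .
  show "jacobip a b n \<noteq> 0" "degree (jacobip a b n) \<le> n"
    using c jacobiP_nonzero[OF ab(1)] degree_jacobiP_le by auto
  show "jint a b (jacobip a b n * q) = 0" if "degree q < n" for q
    using jint_jacobiP_orthogonal[OF ab that] by (simp add: c jint_smult ab)
qed

theorem mainTheorem10:
  fixes a b s :: real and m :: nat
  assumes "a \<ge> b" and "b \<ge> -1/2" and "s \<in> {1, -1}"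
  shows "(m \<ge> 1 \<longrightarrow> locally_s_optimal s a b (Ppoly a b m)) \<and>
         (m \<ge> 2 \<longrightarrow> locally_s_optimal s a b (Qpoly a b m))"
proof (intro conjI impI)
  have ab: "a > -1" "b > -1" using assms by auto
  then have ab1: "a + 1 > -1" "b + 1 > -1" by auto
  show "locally_s_optimal s a b (Ppoly a b m)" if "m \<ge> 1"
  proof -
    let ?p = "jacobip (a + 1) b m"
    have "locally_s_optimal s a b ([:1, -1:] * ((\<Prod>y\<in>{}. [:-y, 1:]) *
        (?p^2 div [:Max {x. poly ?p x = 0}, -1:])))"
      using jacobip_orthogonal[OF ab1(1) ab(2), where n = m] that
      by (intro locally_s_optimal_node_poly[OF ab assms(3), where n = m]) auto
    then show ?thesis
      unfolding Ppoly_def largest_zero_def by (simp only: prod.empty mult_1)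
  qed
  show "locally_s_optimal s a b (Qpoly a b m)" if "m \<ge> 2"
  proof -
    let ?p = "jacobip (a + 1) (b + 1) (m - 1)"
    \<comment> \<open>The node \<open>-1\<close> supplies the factor \<open>1 + x\<close> that
      completes \<open>1 - x^2\<close>; \<open>m \<ge> 2\<close> gives \<open>m - 1 \<ge> 1\<close>,
      so a largest zero exists.\<close>
    have "locally_s_optimal s a b ([:1, -1:] * ((\<Prod>y\<in>{-1}. [:-y, 1:]) *
        (?p^2 div [:Max {x. poly ?p x = 0}, -1:])))"
      using jacobip_orthogonal[OF ab1, where n = "m - 1"] that
      by (intro locally_s_optimal_node_poly[OF ab assms(3), where n = "m - 1"]) auto
    also have "[:1, -1:] * ((\<Prod>y\<in>{-1}. [:-y, 1:]) * u) = [:1, 0, -1:] * u" for u :: "real poly"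
      by simp
    finally show ?thesis
      unfolding Qpoly_def largest_zero_def .
  qed
qed

end
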